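(* Let $\mathcal{P}$ be a property of trees (invariant under isomorphism) that is Stretching-preserving and Expanding-preserving. If some tree $T$ on $n$ vertices satisfies $\mathcal{P}$, then every tree on $n$ vertices satisfies $\mathcal{P}$.
   Context: All graphs are finite, undirected and simple. For a vertex $u$ of a graph, $N(u)$ is its set of neighbors and $N[u]=\{u\}\cup N(u)$. A leaf is a vertex of degree one. Stretching a tree $T$ at a leaf $a$: let $T$ be a tree with $n\geq 3$ vertices and let $a$ be a leaf of $T$. Let $T'$ be obtained from $T$ by deleting a leaf $b$ of $T$ with $b\neq a$ and adding a new vertex joined only to $a$. Then $T'$ is said to be obtained by Stretching $T$ at leaf $a$ (any choice of $b$ is allowed). Expanding a tree $T$ at a vertex $u$: let $2\leq d\leq n-2$ and let $T$ be a tree with $n\geq 4$ vertices. Let $u\in V(T)$ with $N(u)=\{z_0,z_1,\dots,z_{d-1}\}$ be such that $z_i$ is a leaf of $T$ for each $1\le i\le d-1$ and $z_0$ is not a leaf. Let $T'$ be obtained from $T$ by deleting a leaf $b$ of $T$ with $b\notin N[u]$ and adding a new vertex joined only to $u$. Then $T'$ is said to be obtained by Expanding $T$ at vertex $u$ (any choice of $b$ is allowed). A property $\mathcal{P}$ is Stretching-preserving (respectively Expanding-preserving) if, whenever a tree $T$ satisfies $\mathcal{P}$ and $T'$ is obtained by Stretching $T$ at a leaf (respectively Expanding $T$ at a vertex), $T'$ also satisfies $\mathcal{P}$. *)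

theory Defs
  imports "Graph_Theory.Graph_Theory"
begin

text \<open>
  Finite simple undirected graphs are modelled, as in the library, by \<^locale>\<open>pair_graph\<close>: finite
  loop-free digraphs without parallel arcs whose arc relation is symmetric.

  The library predicate \<^const>\<open>tree\<close> is not used: for a symmetric digraph the closed walk
  \<open>u, v, u\<close> counts as a \<^const>\<open>pre_digraph.cycle\<close>, so a graph with an edge is never a \<^const>\<open>tree\<close>.
  The cycles of the undirected graph are the directed ones of length at least three.
\<close>

definition undirected_tree :: "'a pair_pre_digraph \<Rightarrow> bool" where
  "undirected_tree T \<longleftrightarrow> pair_graph T \<and> Digraph_Component.connected (with_proj T) \<and>
     \<not> (\<exists>p. pre_digraph.cycle (with_proj T) p \<and> 3 \<le> length p)"

definition neighbors :: "'a pair_pre_digraph \<Rightarrow> 'a \<Rightarrow> 'a set" where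
  "neighbors T u = {v. (u, v) \<in> parcs T}"

definition closed_neighbors :: "'a pair_pre_digraph \<Rightarrow> 'a \<Rightarrow> 'a set" where
  "closed_neighbors T u = {u} \<union> neighbors T u"

text \<open>By symmetry, the degree in the undirected graph is the out-degree.\<close>

definition leaf :: "'a pair_pre_digraph \<Rightarrow> 'a \<Rightarrow> bool" where
  "leaf T v \<longleftrightarrow> v \<in> pverts T \<and> out_degree (with_proj T) v = 1"

definition delete_vertex :: "'a pair_pre_digraph \<Rightarrow> 'a \<Rightarrow> 'a pair_pre_digraph" where
  "delete_vertex T b =
     \<lparr> pverts = pverts T - {b}, parcs = {e \<in> parcs T. fst e \<noteq> b \<and> snd e \<noteq> b} \<rparr>"

definition attach_vertex :: "'a pair_pre_digraph \<Rightarrow> 'a \<Rightarrow> 'a \<Rightarrow> 'a pair_pre_digraph" where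
  "attach_vertex T u w =
     \<lparr> pverts = insert w (pverts T), parcs = parcs T \<union> {(u, w), (w, u)} \<rparr>"

text \<open>
  In both operations the added vertex \<open>w\<close> is new with respect to the graph remaining after the
  deletion, so the name \<open>b\<close> may be reused. For isomorphism-invariant properties the
  choice of name is irrelevant; this reading avoids requiring unused elements in the type of
  vertices.
\<close>

definition stretching :: "'a pair_pre_digraph \<Rightarrow> 'a \<Rightarrow> 'a pair_pre_digraph \<Rightarrow> bool" where
  "stretching T a T' \<longleftrightarrow>
     undirected_tree T \<and> 3 \<le> card (pverts T) \<and> leaf T a \<and>
     (\<exists>b w. leaf T b \<and> b \<noteq> a \<and> w \<notin> pverts (delete_vertex T b) \<and>
        T' = attach_vertex (delete_vertex T b) a w)"

definition expanding :: "'a pair_pre_digraph \<Rightarrow> 'a \<Rightarrow> 'a pair_pre_digraph \<Rightarrow> bool" where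
  "expanding T u T' \<longleftrightarrow>
     undirected_tree T \<and> 4 \<le> card (pverts T) \<and> u \<in> pverts T \<and>
     (\<exists>(d::nat) z. 2 \<le> d \<and> d \<le> card (pverts T) - 2 \<and>
        bij_betw z {0..d - 1} (neighbors T u) \<and>
        (\<forall>i\<in>{1..d - 1}. leaf T (z i)) \<and> \<not> leaf T (z 0)) \<and>
     (\<exists>b w. leaf T b \<and> b \<notin> closed_neighbors T u \<and> w \<notin> pverts (delete_vertex T b) \<and>
        T' = attach_vertex (delete_vertex T b) u w)"

definition iso_invariant :: "('a pair_pre_digraph \<Rightarrow> bool) \<Rightarrow> bool" where
  "iso_invariant P \<longleftrightarrow>
     (\<forall>T T'. undirected_tree T \<and> undirected_tree T' \<and> digraph_iso (with_proj T) (with_proj T') \<and> P T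
        \<longrightarrow> P T')"

definition stretching_preserving :: "('a pair_pre_digraph \<Rightarrow> bool) \<Rightarrow> bool" where
  "stretching_preserving P \<longleftrightarrow>
     (\<forall>T a T'. undirected_tree T \<and> P T \<and> stretching T a T' \<longrightarrow> P T')"

definition expanding_preserving :: "('a pair_pre_digraph \<Rightarrow> bool) \<Rightarrow> bool" where
  "expanding_preserving P \<longleftrightarrow>
     (\<forall>T u T'. undirected_tree T \<and> P T \<and> expanding T u T' \<longrightarrow> P T')"

end

theory Submission
  imports Defs
begin

text \<open>
  Let \<open>T\<close> be a tree with property \<open>P\<close> and \<open>S\<close> any tree with as many vertices, at least three, since
  smaller trees of equal size are isomorphic. Root \<open>T\<close> at a leaf \<open>a\<close> and \<open>S\<close> at a leaf \<open>r\<close>.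
  One builds \<open>S\<close> on top of \<open>T\<close>, identifying \<open>r\<close> with \<open>a\<close>, while \<open>T\<close> is consumed: at
  any time the graph is a tree glued from an upper part of \<open>S\<close> and a remaining part of \<open>T\<close> that meet
  in the common root only. The next vertex \<open>b\<close> of \<open>S\<close> is supplied by a deepest vertex of
  what is left of \<open>T\<close>, which is a leaf; it is deleted and attached again to the vertex \<open>u\<close> that is its
  parent in \<open>S\<close>. If \<open>S\<close> is built in the order of increasing depth, this is one of the two
  operations:

  \<^item> if no child of \<open>u\<close> has been attached yet, \<open>u\<close> is a leaf of the current tree and the move is a
    stretching at \<open>u\<close>; this includes the first move, where \<open>u\<close> is the root, a leaf of \<open>T\<close>;
  \<^item> otherwise \<open>u\<close> is not the root, because \<open>r\<close> has a single child in \<open>S\<close>. The children of \<open>u\<close>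
    attached so far are as deep in \<open>S\<close> as \<open>b\<close>, so their own children are still to come and they are
    leaves. The parent of \<open>u\<close> is not a leaf: it has a parent itself, or it is the root, which still
    has a neighbour in the remaining part of \<open>T\<close>. So the move is an expanding at \<open>u\<close>.

  A rooted tree is described by a parent function that decreases a depth by one. Moving the leaf \<open>b\<close>
  then changes one value of the function, and the glued trees are the functions that follow \<open>S\<close>
  on a set \<open>M\<close> of moved vertices and \<open>T\<close> elsewhere. The single move is \<open>regraft_leaf\<close>, the iteration
  is \<open>regrafting_preserves\<close>, and \<open>undirected_tree_imp_parent_graph\<close> supplies the parent functions.
  Invariance under isomorphism is applied once, at the end, to a copy of \<open>S\<close> on the vertices of \<open>T\<close>
  in which the vertex consumed at each step is the one that has to be added.
\<close>

section \<open>Graphs of parent functions\<close>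

definition parent_graph :: "'a set \<Rightarrow> 'a \<Rightarrow> ('a \<Rightarrow> 'a) \<Rightarrow> 'a pair_pre_digraph" where
  "parent_graph V a h =
     \<lparr> pverts = V, parcs = (\<Union>v\<in>V - {a}. {(v, h v), (h v, v)}) \<rparr>"

locale rooted_tree =
  fixes V :: "'a set" and a :: 'a and h :: "'a \<Rightarrow> 'a" and depth :: "'a \<Rightarrow> nat"
  assumes finite_V: "finite V"
    and root_in: "a \<in> V"
    and depth_root: "depth a = 0"
    and parent_in: "\<And>v. v \<in> V \<Longrightarrow> v \<noteq> a \<Longrightarrow> h v \<in> V"
    and depth_parent: "\<And>v. v \<in> V \<Longrightarrow> v \<noteq> a \<Longrightarrow> depth v = Suc (depth (h v))"

lemma pverts_parent_graph [simp]: "pverts (parent_graph V a h) = V"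
  by (simp add: parent_graph_def)

lemma parcs_parent_graph:
  "(x, y) \<in> parcs (parent_graph V a h) \<longleftrightarrow>
     x \<in> V \<and> x \<noteq> a \<and> y = h x \<or> y \<in> V \<and> y \<noteq> a \<and> x = h y"
  by (auto simp: parent_graph_def)

lemma parent_graph_cong:
  "(\<And>v. v \<in> V \<Longrightarrow> v \<noteq> a \<Longrightarrow> h v = h' v) \<Longrightarrow> parent_graph V a h = parent_graph V a h'"
  by (simp add: parent_graph_def)

lemma neighbors_parent_graph:
  "neighbors (parent_graph V a h) u =
     {y. u \<in> V \<and> u \<noteq> a \<and> y = h u} \<union> {y \<in> V - {a}. h y = u}"
  by (auto simp: neighbors_def parcs_parent_graph)

lemma leaf_iff_neighbors: "leaf T v \<longleftrightarrow> v \<in> pverts T \<and> card (neighbors T v) = 1"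
proof -
  have "out_arcs (with_proj T) v = Pair v ` neighbors T v"
    by (auto simp: out_arcs_def neighbors_def)
  then show ?thesis
    by (simp add: leaf_def out_degree_def card_image inj_on_def)
qed

lemma finite_obtains_maximal:
  fixes f :: "'b \<Rightarrow> nat"
  assumes "finite A" "A \<noteq> {}"
  obtains x where "x \<in> A" "\<And>y. y \<in> A \<Longrightarrow> f y \<le> f x"
proof -
  have "Max (f ` A) \<in> f ` A" using assms by simp
  then obtain x where "x \<in> A" "Max (f ` A) = f x" by (rule imageE)
  moreover have "f y \<le> Max (f ` A)" if "y \<in> A" for y using assms that by simp
  ultimately show thesis using that by simp
qed

context rooted_tree
begin

lemma parent_neq: "v \<in> V \<Longrightarrow> v \<noteq> a \<Longrightarrow> h v \<noteq> v"
  using depth_parent by (metis n_not_Suc_n)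

lemma leaf_nonroot:
  assumes "v \<in> V" "v \<noteq> a" "\<And>w. w \<in> V \<Longrightarrow> w \<noteq> a \<Longrightarrow> h w \<noteq> v"
  shows "leaf (parent_graph V a h) v"
proof -
  have "neighbors (parent_graph V a h) v = {h v}"
    using assms by (auto simp: neighbors_parent_graph)
  then show ?thesis using assms by (simp add: leaf_iff_neighbors)
qed

lemma not_leaf_nonroot:
  assumes "v \<in> V" "v \<noteq> a" "w \<in> V" "w \<noteq> a" "h w = v"
  shows "\<not> leaf (parent_graph V a h) v"
proof -
  have "depth w = Suc (Suc (depth (h v)))"
    using depth_parent assms by metis
  then have "h v \<noteq> w" by auto
  moreover have "{h v, w} \<subseteq> neighbors (parent_graph V a h) v"
    using assms by (auto simp: neighbors_parent_graph)
  ultimately have "card (neighbors (parent_graph V a h) v) \<noteq> 1"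
    by (auto simp: card_1_singleton_iff)
  then show ?thesis by (simp add: leaf_iff_neighbors)
qed

lemma pair_graph_parent_graph: "pair_graph (parent_graph V a h)"
proof
  show "\<And>e. e \<in> parcs (parent_graph V a h) \<Longrightarrow> fst e \<in> pverts (parent_graph V a h)"
    and "\<And>e. e \<in> parcs (parent_graph V a h) \<Longrightarrow> snd e \<in> pverts (parent_graph V a h)"
    and "\<And>e. e \<in> parcs (parent_graph V a h) \<Longrightarrow> fst e \<noteq> snd e"
    using parent_in parent_neq by (fastforce simp: parent_graph_def)+
  show "finite (pverts (parent_graph V a h))" "finite (parcs (parent_graph V a h))"
    using finite_V by (auto simp: parent_graph_def)
  show "symmetric (with_proj (parent_graph V a h))"
    by (auto simp: symmetric_def sym_def parcs_parent_graph)
qed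

lemma reachable_parent_graph:
  assumes "u \<in> V" "v \<in> V"
  shows "u \<rightarrow>\<^sup>*\<^bsub>with_proj (parent_graph V a h)\<^esub> v"
proof -
  interpret G: pair_graph "parent_graph V a h" by (rule pair_graph_parent_graph)
  have to_root: "w \<rightarrow>\<^sup>*\<^bsub>with_proj (parent_graph V a h)\<^esub> a" if "w \<in> V" for w
    using that
  proof (induction "depth w" arbitrary: w rule: less_induct)
    case less
    show ?case
    proof (cases "w = a")
      case True
      then show ?thesis using less.prems by simp
    next
      case False
      then have "h w \<rightarrow>\<^sup>*\<^bsub>with_proj (parent_graph V a h)\<^esub> a"
        using less parent_in depth_parent[of w] by simp
      moreover have "(w, h w) \<in> parcs (parent_graph V a h)"
        using less.prems False by (simp add: parcs_parent_graph)
      ultimately show ?thesis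
        by (metis G.adj_reachable_trans with_proj_simps(3))
    qed
  qed
  have "a \<rightarrow>\<^sup>*\<^bsub>with_proj (parent_graph V a h)\<^esub> v"
    using to_root[OF assms(2)] by (rule G.symmetric_reachable')
  with to_root[OF assms(1)] show ?thesis by (rule G.reachable_trans)
qed

text \<open>Seen from its deeper end, an arc leads to the parent. This yields both the acyclicity of
  parent graphs and the uniqueness of the neighbour of a deepest vertex.\<close>

lemma arc_to_deepest:
  assumes "(x, y) \<in> parcs (parent_graph V a h)" "depth y \<le> depth x"
  shows "y = h x"
  using assms depth_parent[of y] by (auto simp: parcs_parent_graph)

text \<open>A deepest vertex of a cycle has only its parent as a neighbour on the cycle, so the vertices
  before and after it coincide, which a cycle of length at least three does not allow.\<close>

lemma no_long_cycle:
  assumes cyc: "pre_digraph.cycle (with_proj (parent_graph V a h)) p"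
  shows "length p < 3"
proof (rule ccontr)
  assume "\<not> length p < 3"
  then have len: "3 \<le> length p" by simp
  let ?n = "length p"
  interpret G: pair_graph "parent_graph V a h" by (rule pair_graph_parent_graph)
  from cyc obtain u where u: "G.awalk u p u" "distinct (tl (pawalk_verts u p))" "p \<noteq> []"
    by (auto simp: G.cycle_def)
  then have cas: "pcas u p u" and arcs: "set p \<subseteq> parcs (parent_graph V a h)"
    by (auto simp: G.awalk_def)
  have heads: "pawalk_verts u p = u # map snd p"
    using G.awalk_verts_conv'[OF cas] G.awhd_of_awalk[OF u(1)] u(3) cas
    by (cases p) auto
  have tails: "pawalk_verts u p = map fst p @ [u]"
    using G.awalk_verts_conv[of u p] G.awlast_of_awalk[OF u(1)] u(3)
    by (metis (no_types, lifting) G.awlast_if_cas cas last_snoc)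
  have dist: "distinct (map snd p)"
    using u(2) heads by simp
  have both: "u # map snd p = map fst p @ [u]"
    using heads tails by simp
  \<comment> \<open>Positions on the cycle are counted modulo its length.\<close>
  define nxt where "nxt i = (if Suc i < ?n then Suc i else 0)" for i
  define prv where "prv i = (if i = 0 then ?n - 1 else i - 1)" for i
  have nxt: "nxt i < ?n" "snd (p ! i) = fst (p ! nxt i)" if "i < ?n" for i
  proof -
    show "nxt i < ?n" using len by (auto simp: nxt_def)
    have "fst (p ! 0) = u"
      using arg_cong[OF both, of hd] u(3) by (simp add: hd_append hd_conv_nth)
    moreover have "snd (p ! i) = (map fst p @ [u]) ! Suc i"
      using arg_cong[OF both, of "\<lambda>l. l ! Suc i"] that by simp
    ultimately show "snd (p ! i) = fst (p ! nxt i)"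
      using that by (auto simp: nth_append nxt_def)
  qed
  have prv: "prv i < ?n" "nxt (prv i) = i" if "i < ?n" for i
    using that len by (auto simp: nxt_def prv_def)
  \<comment> \<open>Both cycle neighbours of a deepest vertex \<open>x\<close> of the cycle are the parent of \<open>x\<close>.\<close>
  obtain i where i: "i < ?n" "\<And>j. j < ?n \<Longrightarrow> depth (snd (p ! j)) \<le> depth (snd (p ! i))"
    using finite_obtains_maximal[of "{..<?n}" "\<lambda>j. depth (snd (p ! j))"] u(3) by auto
  let ?x = "snd (p ! i)"
  have arc: "p ! j \<in> parcs (parent_graph V a h)" if "j < ?n" for j
    using arcs that nth_mem by blast
  have "fst (p ! i) = snd (p ! prv i)"
    using nxt(2)[of "prv i"] prv i(1) by simp
  moreover have "fst (p ! i) = h ?x"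
  proof (rule arc_to_deepest)
    have "(fst (p ! i), ?x) \<in> parcs (parent_graph V a h)" using arc[OF i(1)] by simp
    then show "(?x, fst (p ! i)) \<in> parcs (parent_graph V a h)" by (rule G.arcs_symmetric)
    show "depth (fst (p ! i)) \<le> depth ?x" using calculation i(2) prv(1) i(1) by simp
  qed
  moreover have "snd (p ! nxt i) = h ?x"
  proof (rule arc_to_deepest)
    show "(?x, snd (p ! nxt i)) \<in> parcs (parent_graph V a h)"
      using arc nxt i(1) by (metis prod.collapse)
    show "depth (snd (p ! nxt i)) \<le> depth ?x" using i(2) nxt(1) i(1) by simp
  qed
  ultimately have "map snd p ! prv i = map snd p ! nxt i"
    using prv(1) nxt(1) i(1) by simp
  then have "prv i = nxt i"
    using dist prv(1) nxt(1) i(1) by (metis distinct_conv_nth length_map)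
  then show False
    using len i(1) by (auto simp: nxt_def prv_def split: if_splits)
qed

lemma undirected_tree_parent_graph: "undirected_tree (parent_graph V a h)"
proof -
  interpret G: pair_graph "parent_graph V a h" by (rule pair_graph_parent_graph)
  have "Digraph_Component.connected (with_proj (parent_graph V a h))"
    using reachable_parent_graph root_in
    by (auto simp: connected_def strongly_connected_def intro: G.reachable_mk_symmetricI)
  then show ?thesis
    using pair_graph_parent_graph no_long_cycle by (force simp: undirected_tree_def)
qed

end

section \<open>Every tree is the graph of a parent function\<close>

text \<open>The parent of a vertex is a neighbour that is closer to the root. This gives a spanning tree
  of \<open>T\<close>, and since \<open>T\<close> is acyclic, the spanning tree is all of \<open>T\<close>.\<close>

lemma undirected_tree_imp_parent_graph:
  assumes T: "undirected_tree T" and a: "a \<in> pverts T"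
  obtains h depth where "rooted_tree (pverts T) a h depth" "T = parent_graph (pverts T) a h"
proof -
  interpret T: pair_graph T using T by (simp add: undirected_tree_def)
  let ?R = "parcs T" and ?V = "pverts T"
  have conn: "strongly_connected (with_proj T)"
    using T T.symmetric_connected_imp_strongly_connected T.sym_arcs
    by (auto simp: undirected_tree_def)
  have walk: "\<exists>k. (a, v) \<in> ?R ^^ k" if "v \<in> ?V" for v
  proof -
    have "a \<rightarrow>\<^sup>*\<^bsub>with_proj T\<^esub> v" using conn a that by (auto simp: strongly_connected_def)
    then have "(a, v) \<in> ?R\<^sup>*"
      by (simp add: reachable_def rtrancl_on_rtranclI)
    then show ?thesis by (simp add: rtrancl_power)
  qed
  define depth where "depth v = (LEAST k. (a, v) \<in> ?R ^^ k)" for v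
  have depth_le: "depth v \<le> k" if "(a, v) \<in> ?R ^^ k" for v k
    using that by (simp add: depth_def Least_le)
  have depth_walk: "(a, v) \<in> ?R ^^ depth v" if "v \<in> ?V" for v
    using walk[OF that] unfolding depth_def by (rule LeastI_ex)
  have "\<exists>y. (v, y) \<in> ?R \<and> depth v = Suc (depth y)" if v: "v \<in> ?V" "v \<noteq> a" for v
  proof -
    obtain k where k: "depth v = Suc k"
      using depth_walk[OF v(1)] v(2) by (cases "depth v") auto
    then obtain y where y: "(a, y) \<in> ?R ^^ k" "(y, v) \<in> ?R"
      using depth_walk[OF v(1)] by auto
    have "Suc (depth y) \<ge> depth v"
      using depth_le[of v "Suc (depth y)"] depth_walk[of y] T.in_arcsD1[OF y(2)] y(2) by auto
    then show ?thesis
      using k depth_le[OF y(1)] T.arcs_symmetric[OF y(2)] by auto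
  qed
  then obtain h where h: "\<And>v. v \<in> ?V \<Longrightarrow> v \<noteq> a \<Longrightarrow> (v, h v) \<in> ?R \<and> depth v = Suc (depth (h v))"
    by metis
  interpret H: rooted_tree ?V a h depth
  proof
    show "depth a = 0" using depth_le[of a 0] by simp
  qed (use h a T.in_arcsD2 T.pair_finite_verts in auto)
  let ?H = "parent_graph ?V a h"
  interpret HG: pair_graph ?H by (rule H.pair_graph_parent_graph)
  have sub: "parcs ?H \<subseteq> parcs T"
    using h T.arcs_symmetric by (auto simp: parent_graph_def)
  \<comment> \<open>An arc of \<open>T\<close> outside the spanning tree closes a cycle with a path of the spanning tree.\<close>
  have "(u, v) \<in> parcs ?H" if uv: "(u, v) \<in> parcs T" for u v
  proof (rule ccontr)
    assume no: "(u, v) \<notin> parcs ?H"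
    have V: "u \<in> ?V" "v \<in> ?V" "u \<noteq> v"
      using T.in_arcsD1[OF uv] T.in_arcsD2[OF uv] T.no_loops'[OF uv] by auto
    obtain p where p: "HG.apath v p u"
      using H.reachable_parent_graph[OF V(2,1)] HG.reachable_apath by auto
    then have pw: "pcas v p u" "set p \<subseteq> parcs ?H" "distinct (pawalk_verts v p)"
      by (auto simp: HG.apath_def HG.awalk_def)
    have "length p \<noteq> 0" using pw(1) V(3) by auto
    moreover have "length p \<noteq> 1"
      using pw(1,2) no HG.arcs_symmetric by (auto simp: length_Suc_conv)
    ultimately have "3 \<le> length ((u, v) # p)" by (cases "length p") auto
    moreover have "T.cycle ((u, v) # p)"
      using pw sub uv V by (auto simp: T.cycle_def T.awalk_def)
    ultimately show False using T by (auto simp: undirected_tree_def)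
  qed
  with sub have "parcs T = parcs ?H" by auto
  then have "T = ?H"
    by (intro pair_pre_digraph.equality) auto
  with H.rooted_tree_axioms show thesis by (rule that)
qed

text \<open>A vertex farthest from an arbitrary root has at most one neighbour and serves as the new root.
  That the root is a leaf is expressed by its having at most one child, which also makes sense for
  the tree with a single vertex.\<close>

lemma undirected_tree_rooted_at_leaf:
  assumes T: "undirected_tree T"
  obtains a h depth where "rooted_tree (pverts T) a h depth" "T = parent_graph (pverts T) a h"
    and "\<And>x y. \<lbrakk>x \<in> pverts T - {a}; y \<in> pverts T - {a}; h x = a; h y = a\<rbrakk> \<Longrightarrow> x = y"
proof -
  let ?V = "pverts T"
  obtain r where r: "r \<in> ?V"
    using T by (auto simp: undirected_tree_def connected_conv)
  obtain g dep where g: "rooted_tree ?V r g dep" "T = parent_graph ?V r g"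
    using undirected_tree_imp_parent_graph[OF T r] by metis
  interpret R: rooted_tree ?V r g dep by (rule g(1))
  obtain a where a: "a \<in> ?V" "\<And>v. v \<in> ?V \<Longrightarrow> dep v \<le> dep a"
    using finite_obtains_maximal[OF R.finite_V, of dep] r by blast
  have unique: "x = y" if "(a, x) \<in> parcs T" "(a, y) \<in> parcs T" for x y
  proof -
    have "x \<in> ?V" "y \<in> ?V"
      using that g(2) R.parent_in R.root_in by (metis parcs_parent_graph)+
    then show ?thesis
      using that a(2) g(2) R.arc_to_deepest by metis
  qed
  obtain h depth where h: "rooted_tree ?V a h depth" "T = parent_graph ?V a h"
    using undirected_tree_imp_parent_graph[OF T a(1)] by metis
  have "x = y" if "x \<in> ?V - {a}" "y \<in> ?V - {a}" "h x = a" "h y = a" for x y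
    using that by (intro unique; subst h(2); simp add: parcs_parent_graph)
  with h show thesis by (rule that)
qed

section \<open>Moving a leaf\<close>

text \<open>The attached vertex reuses the name of the deleted one, so all trees of the construction share
  one vertex set, even if the type has no further elements.\<close>

lemma attach_delete_parent_graph:
  assumes "a \<in> V" "b \<in> V" "b \<noteq> a" "u \<in> V" "u \<noteq> b"
    and "\<And>v. v \<in> V \<Longrightarrow> v \<noteq> a \<Longrightarrow> h v \<noteq> b"
  shows "attach_vertex (delete_vertex (parent_graph V a h) b) u b = parent_graph V a (h(b := u))"
  using assms by (auto simp: attach_vertex_def delete_vertex_def parent_graph_def split: if_splits)

lemma bij_betw_nat_with_first:
  assumes "finite N" "y \<in> N"
  obtains z where "bij_betw z {0..card N - 1} N" "z 0 = y"
proof -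
  have "{0..card N - 1} = {0..<card N}"
    using assms by (cases "card N") auto
  then obtain f where f: "bij_betw f {0..card N - 1} N"
    using ex_bij_betw_nat_finite[OF assms(1)] by metis
  then obtain i where i: "i \<in> {0..card N - 1}" "f i = y"
    using assms(2) by (metis bij_betw_imp_surj_on imageE)
  have "bij_betw (Transposition.transpose 0 i) {0..card N - 1} {0..card N - 1}"
    using i(1) by simp
  then have "bij_betw (f \<circ> Transposition.transpose 0 i) {0..card N - 1} N"
    using f by (rule bij_betw_trans)
  moreover have "(f \<circ> Transposition.transpose 0 i) 0 = y"
    using i(2) by simp
  ultimately show thesis by (rule that)
qed

context rooted_tree
begin

lemma stretching_move_leaf:
  assumes "b \<in> V" "b \<noteq> a" "\<And>v. v \<in> V \<Longrightarrow> v \<noteq> a \<Longrightarrow> h v \<noteq> b"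
    and "leaf (parent_graph V a h) u" "u \<noteq> b" "3 \<le> card V"
  shows "stretching (parent_graph V a h) u (parent_graph V a (h(b := u)))"
proof -
  have "u \<in> V" using assms(4) by (simp add: leaf_def)
  then have "attach_vertex (delete_vertex (parent_graph V a h) b) u b = parent_graph V a (h(b := u))"
    using root_in assms by (intro attach_delete_parent_graph) auto
  moreover have "leaf (parent_graph V a h) b"
    using assms by (intro leaf_nonroot)
  moreover have "b \<notin> pverts (delete_vertex (parent_graph V a h) b)"
    by (simp add: delete_vertex_def)
  ultimately show ?thesis
    unfolding stretching_def pverts_parent_graph using assms
    by (intro conjI undirected_tree_parent_graph exI[of _ b]) auto
qed

text \<open>The bounds on the degree in the definition of expanding come for free: \<open>u\<close> has the two
  neighbours \<open>h u\<close> and \<open>x\<close>, and neither \<open>u\<close> nor \<open>b\<close> is a neighbour of \<open>u\<close>.\<close>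

lemma expanding_move_leaf:
  assumes b: "b \<in> V" "b \<noteq> a" "\<And>v. v \<in> V \<Longrightarrow> v \<noteq> a \<Longrightarrow> h v \<noteq> b" "h b \<noteq> u"
    and u: "u \<in> V" "u \<noteq> a" "u \<noteq> b" "\<not> leaf (parent_graph V a h) (h u)"
    and x: "x \<in> V" "x \<noteq> a" "h x = u"
    and grandchildless: "\<And>y z. \<lbrakk>y \<in> V - {a}; z \<in> V - {a}; h y = u\<rbrakk> \<Longrightarrow> h z \<noteq> y"
  shows "expanding (parent_graph V a h) u (parent_graph V a (h(b := u)))"
proof -
  let ?G = "parent_graph V a h" and ?N = "neighbors (parent_graph V a h) u"
  have N: "?N = insert (h u) {y \<in> V - {a}. h y = u}"
    using u by (auto simp: neighbors_parent_graph)
  then have fin: "finite ?N" using finite_V by simp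
  have sub: "?N \<subseteq> V - {u, b}"
    unfolding N using u(1,2) b parent_in parent_neq[OF u(1,2), symmetric] by auto
  have "depth x = Suc (Suc (depth (h u)))"
    using depth_parent[OF x(1,2)] depth_parent[OF u(1,2)] x(3) by simp
  then have "x \<noteq> h u" by auto
  moreover have "{h u, x} \<subseteq> ?N" using N x by auto
  ultimately have two: "2 \<le> card ?N"
    using card_mono[OF fin, of "{h u, x}"] by simp
  have "card ?N \<le> card (V - {u, b})"
    using sub finite_V by (intro card_mono) auto
  also have "\<dots> = card V - 2"
    using u(1,3) b(1) finite_V by (subst card_Diff_subset) auto
  finally have upper: "card ?N \<le> card V - 2" .
  obtain z where z: "bij_betw z {0..card ?N - 1} ?N" "z 0 = h u"
    using bij_betw_nat_with_first[OF fin, of "h u"] N by auto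
  have leaves: "leaf ?G (z i)" if i: "i \<in> {1..card ?N - 1}" for i
  proof -
    have "z i \<in> ?N" using z(1) i by (auto simp: bij_betw_def)
    moreover have "z i \<noteq> z 0"
      using inj_onD[OF bij_betw_imp_inj_on[OF z(1)], of i 0] i by auto
    ultimately have zi: "z i \<in> V - {a}" "h (z i) = u" using N z(2) by auto
    then show ?thesis using grandchildless by (intro leaf_nonroot) auto
  qed
  have "attach_vertex (delete_vertex ?G b) u b = parent_graph V a (h(b := u))"
    using root_in b u by (intro attach_delete_parent_graph) auto
  moreover have "leaf ?G b" using b by (intro leaf_nonroot)
  moreover have "b \<notin> closed_neighbors ?G u"
    using sub u(3) by (auto simp: closed_neighbors_def)
  moreover have "b \<notin> pverts (delete_vertex ?G b)" by (simp add: delete_vertex_def)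
  moreover have "\<not> leaf ?G (z 0)" using u(4) z(2) by simp
  moreover have "4 \<le> card V" using two upper by simp
  ultimately show ?thesis
    unfolding expanding_def pverts_parent_graph
    by (intro conjI undirected_tree_parent_graph u(1) exI[of _ "card ?N"] exI[of _ z]
        exI[of _ b] two upper z(1) ballI leaves) auto
qed

end

section \<open>Regrafting one tree into another\<close>

text \<open>The set \<open>M\<close> holds the vertices already moved. They are shallowest in the target \<open>q\<close>, so that
  \<open>M\<close> together with the root is closed under \<open>q\<close>, and deepest in the source \<open>p\<close>, so that the
  complement of \<open>M\<close> is closed under \<open>p\<close>. The two trees given by these sets meet in the root
  only.\<close>

locale regrafting =
  src: rooted_tree V a p t + tgt: rooted_tree V a q s
  for V :: "'a set" and a p t q s +
  fixes M :: "'a set"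
  assumes moved: "M \<subseteq> V - {a}"
    and shallow_first: "\<And>x y. \<lbrakk>x \<in> M; y \<in> V - {a} - M\<rbrakk> \<Longrightarrow> s x \<le> s y"
    and deep_first: "\<And>x y. \<lbrakk>x \<in> M; y \<in> V - {a} - M\<rbrakk> \<Longrightarrow> t y \<le> t x"
    and src_root_leaf: "\<And>x y. \<lbrakk>x \<in> V - {a}; y \<in> V - {a}; p x = a; p y = a\<rbrakk> \<Longrightarrow> x = y"
    and tgt_root_leaf: "\<And>x y. \<lbrakk>x \<in> V - {a}; y \<in> V - {a}; q x = a; q y = a\<rbrakk> \<Longrightarrow> x = y"
begin

definition mixed :: "'a \<Rightarrow> 'a" where
  "mixed v = (if v \<in> M then q v else p v)"

lemma tgt_parent_moved:
  assumes "x \<in> M" "q x \<noteq> a"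
  shows "q x \<in> M"
proof (rule ccontr)
  assume "q x \<notin> M"
  then have "s x \<le> s (q x)"
    using assms moved tgt.parent_in by (intro shallow_first) auto
  then show False using tgt.depth_parent[of x] assms moved by auto
qed

lemma src_parent_unmoved:
  assumes "y \<in> V - {a} - M"
  shows "p y \<notin> M"
proof
  assume "p y \<in> M"
  then have "t y \<le> t (p y)" using assms by (intro deep_first)
  then show False using src.depth_parent[of y] assms by auto
qed

text \<open>Depths of source and target can be combined without shifting, since no parent step leads from
  one part to the other except to the root, where both depths vanish.\<close>

sublocale mixed: rooted_tree V a mixed "\<lambda>v. if v \<in> M then s v else t v"
proof
  show "finite V" "a \<in> V" by (fact src.finite_V src.root_in)+
  show "(if a \<in> M then s a else t a) = 0"
    by (simp add: src.depth_root tgt.depth_root)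
  fix v assume v: "v \<in> V" "v \<noteq> a"
  then show "mixed v \<in> V"
    using src.parent_in tgt.parent_in by (simp add: mixed_def)
  show "(if v \<in> M then s v else t v) = Suc (if mixed v \<in> M then s (mixed v) else t (mixed v))"
  proof (cases "v \<in> M")
    case True
    then have "mixed v = q v" "q v = a \<or> q v \<in> M"
      using tgt_parent_moved by (auto simp: mixed_def)
    then show ?thesis
      using True tgt.depth_parent[OF v] moved src.depth_root tgt.depth_root by auto
  next
    case False
    then have "mixed v = p v" "p v \<notin> M"
      using src_parent_unmoved[of v] v by (auto simp: mixed_def)
    then show ?thesis
      using False src.depth_parent[OF v] by auto
  qed
qed

text \<open>Following parents leads to the root without leaving the part of the tree where one started.\<close>

lemma root_parent_of_unmoved:
  assumes "y \<in> V - {a} - M"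
  shows "\<exists>z\<in>V - {a} - M. p z = a"
  using assms
proof (induction "t y" arbitrary: y rule: less_induct)
  case less
  then show ?case
    using src.parent_in[of y] src.depth_parent[of y] src_parent_unmoved[of y]
    by (cases "p y = a") auto
qed

lemma root_parent_of_moved:
  assumes "x \<in> M"
  shows "\<exists>z\<in>M. q z = a"
  using assms
proof (induction "s x" arbitrary: x rule: less_induct)
  case less
  then have "x \<in> V" "x \<noteq> a" using moved by auto
  then have "s (q x) < s x" using tgt.depth_parent by simp
  then show ?case
    using less tgt_parent_moved[of x] by blast
qed

text \<open>The graph stays the same only for two vertices, where moving the leaf \<open>b\<close> puts it back in its
  place. Neither operation is available there.\<close>

lemma regraft_leaf:
  assumes b: "b \<in> V - {a} - M"
    and b_shallow: "\<And>y. y \<in> V - {a} - M \<Longrightarrow> s b \<le> s y"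
    and b_deep: "\<And>y. y \<in> V - {a} - M \<Longrightarrow> t y \<le> t b"
  shows "parent_graph V a (mixed(b := q b)) = parent_graph V a mixed
    \<or> stretching (parent_graph V a mixed) (q b) (parent_graph V a (mixed(b := q b)))
    \<or> expanding (parent_graph V a mixed) (q b) (parent_graph V a (mixed(b := q b)))"
proof -
  let ?G = "parent_graph V a mixed"
  have bV: "b \<in> V" "b \<noteq> a" "b \<notin> M" using b by auto
  have childless: "mixed v \<noteq> b" if v: "v \<in> V" "v \<noteq> a" for v
  proof (cases "v \<in> M")
    case True
    then show ?thesis using tgt_parent_moved[of v] bV by (auto simp: mixed_def)
  next
    case False
    then have "p v \<noteq> b"
      using b_deep[of v] src.depth_parent[OF v] v by auto
    then show ?thesis using False by (simp add: mixed_def)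
  qed
  have qb: "q b \<in> V" "q b \<noteq> b" "q b = a \<or> q b \<in> M"
    using bV tgt.parent_in[of b] tgt.parent_neq[of b] b_shallow[of "q b"] tgt.depth_parent[of b]
    by auto
  show ?thesis
  proof (cases "M = {}")
    case True
    have [simp]: "mixed = p"
      unfolding mixed_def fun_eq_iff using True by simp
    have qa: "q b = a" using qb(3) True by simp
    show ?thesis
    proof (cases "3 \<le> card V")
      case True
      obtain z where z: "z \<in> V - {a}" "p z = a"
        using root_parent_of_unmoved[OF b] by auto
      then have "neighbors ?G a = {z}"
        using src_root_leaf by (auto simp: neighbors_parent_graph)
      then have "leaf ?G (q b)"
        using qa src.root_in by (simp add: leaf_iff_neighbors)
      then show ?thesis
        using mixed.stretching_move_leaf[OF bV(1,2) childless _ qb(2) True] by blast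
    next
      case False
      have "p b = a"
      proof (rule ccontr)
        assume "p b \<noteq> a"
        then have "card {a, b, p b} = 3"
          using src.parent_neq[OF bV(1,2)] bV(2) by auto
        moreover have "{a, b, p b} \<subseteq> V"
          using src.root_in src.parent_in bV by auto
        ultimately show False
          using False card_mono[OF src.finite_V] by metis
      qed
      then show ?thesis using qa by (auto simp: fun_upd_idem)
    qed
  next
    case False
    then obtain c where c: "c \<in> M" "q c = a" using root_parent_of_moved by blast
    \<comment> \<open>The single child of the root is the first vertex to be moved, so \<open>b\<close> is not that child.\<close>
    have "q b \<noteq> a" using tgt_root_leaf[of b c] c b moved by auto
    with qb have u: "q b \<in> M" "q b \<in> V" "q b \<noteq> a" "q b \<noteq> b" by auto
    have child: "v \<in> M \<and> q v = w" if "v \<in> V - {a}" "mixed v = w" "w \<in> M" for v w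
      using that src_parent_unmoved[of v] by (auto simp: mixed_def split: if_splits)
    show ?thesis
    proof (cases "\<exists>x\<in>V - {a}. mixed x = q b")
      case False
      then have "leaf ?G (q b)" using u by (intro mixed.leaf_nonroot) auto
      moreover have "card {a, b, q b} \<le> card V"
        using src.finite_V src.root_in bV u by (intro card_mono) auto
      then have "3 \<le> card V" using bV u by auto
      ultimately show ?thesis
        using mixed.stretching_move_leaf[OF bV(1,2) childless _ qb(2)] by blast
    next
      case True
      then obtain x where x: "x \<in> V" "x \<noteq> a" "mixed x = q b" by auto
      \<comment> \<open>A moved child of a sibling of \<open>b\<close> would be deeper in the target than \<open>b\<close>, which is still unmoved.\<close>
      have grandchildless: "mixed z \<noteq> y"
        if yz: "y \<in> V - {a}" "z \<in> V - {a}" "mixed y = q b" for y z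
      proof
        assume zy: "mixed z = y"
        have y: "y \<in> M" "q y = q b" using child[OF yz(1,3) u(1)] by auto
        then have z: "z \<in> M" "q z = y" using child[OF yz(2) zy] by auto
        have "s z = Suc (s b)"
          using tgt.depth_parent[of z] tgt.depth_parent[of y] tgt.depth_parent[of b] yz y z bV
          by simp
        then show False using shallow_first[OF z(1) b] by simp
      qed
      have mu: "mixed (q b) = q (q b)" using u(1) by (simp add: mixed_def)
      \<comment> \<open>If the parent is the root, its second neighbour lies in the source part, which is not used up
        because it contains \<open>b\<close>.\<close>
      have "\<not> leaf ?G (mixed (q b))"
      proof (cases "q (q b) = a")
        case False
        then show ?thesis
          using mu u tgt.parent_in[of "q b"] by (intro mixed.not_leaf_nonroot[of _ "q b"]) auto
      next
        case True
        obtain z where z: "z \<in> V - {a} - M" "p z = a"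
          using root_parent_of_unmoved[OF b] by auto
        then have "{q b, z} \<subseteq> neighbors ?G a"
          using True mu u by (auto simp: neighbors_parent_graph mixed_def)
        moreover have "q b \<noteq> z" using z u by auto
        ultimately show ?thesis
          using True mu by (auto simp: leaf_iff_neighbors card_1_singleton_iff)
      qed
      moreover have "mixed b \<noteq> q b"
        using src_parent_unmoved[OF b] u(1) bV by (auto simp: mixed_def)
      ultimately show ?thesis
        using mixed.expanding_move_leaf[OF bV(1,2) childless _ u(2,3,4) _ x grandchildless]
        by blast
    qed
  qed
qed

end

text \<open>The list \<open>xs\<close> is the order in which the vertices are moved. That it increases in target depth
  and decreases in source depth at the same time is arranged by choosing how the vertices of the
  target are named.\<close>

lemma regrafting_preserves:
  assumes pres: "stretching_preserving P" "expanding_preserving P"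
    and src: "rooted_tree V a p t"
    and tgt: "rooted_tree V a q s"
    and src_root: "\<And>x y. \<lbrakk>x \<in> V - {a}; y \<in> V - {a}; p x = a; p y = a\<rbrakk> \<Longrightarrow> x = y"
    and tgt_root: "\<And>x y. \<lbrakk>x \<in> V - {a}; y \<in> V - {a}; q x = a; q y = a\<rbrakk> \<Longrightarrow> x = y"
    and xs: "distinct xs" "set xs = V - {a}"
    and shallow: "sorted_wrt (\<lambda>x y. s x \<le> s y) xs"
    and deep: "sorted_wrt (\<lambda>x y. t y \<le> t x) xs"
    and P: "P (parent_graph V a p)"
  shows "P (parent_graph V a q)"
proof -
  have "P (parent_graph V a (\<lambda>v. if v \<in> set ys then q v else p v))" if "xs = ys @ zs" for ys zs
    using that
  proof (induction ys arbitrary: zs rule: rev_induct)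
    case Nil
    then show ?case using P by simp
  next
    case (snoc b ys)
    have "distinct (ys @ b # zs)" and xs': "V - {a} = set (ys @ b # zs)"
      using xs snoc.prems by simp_all
    then have unmoved: "V - {a} - set ys = insert b (set zs)" and b: "b \<notin> set ys"
      and ys: "set ys \<subseteq> V - {a}"
      unfolding xs' by auto
    interpret src: rooted_tree V a p t by (rule src)
    interpret tgt: rooted_tree V a q s by (rule tgt)
    have moved_before: "s x \<le> s y" "t y \<le> t x" if "x \<in> set ys" "y \<in> insert b (set zs)" for x y
      using that shallow deep snoc.prems by (auto simp: sorted_wrt_append)
    have b_first: "s b \<le> s y" "t y \<le> t b" if "y \<in> insert b (set zs)" for y
      using that shallow deep snoc.prems by (auto simp: sorted_wrt_append)
    interpret R: regrafting V a p t q s "set ys"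
    proof
      show "x = y" if "x \<in> V - {a}" "y \<in> V - {a}" "p x = a" "p y = a" for x y
        using that by (rule src_root)
      show "x = y" if "x \<in> V - {a}" "y \<in> V - {a}" "q x = a" "q y = a" for x y
        using that by (rule tgt_root)
    qed (use ys moved_before in \<open>auto simp: unmoved\<close>)
    have mixed: "R.mixed = (\<lambda>v. if v \<in> set ys then q v else p v)"
      by (simp add: R.mixed_def fun_eq_iff)
    have old: "P (parent_graph V a R.mixed)"
      unfolding mixed using snoc.prems by (intro snoc.IH) simp
    have "parent_graph V a (R.mixed(b := q b)) = parent_graph V a R.mixed
      \<or> stretching (parent_graph V a R.mixed) (q b) (parent_graph V a (R.mixed(b := q b)))
      \<or> expanding (parent_graph V a R.mixed) (q b) (parent_graph V a (R.mixed(b := q b)))"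
      by (rule R.regraft_leaf) (use b_first in \<open>auto simp: unmoved\<close>)
    then have "P (parent_graph V a (R.mixed(b := q b)))"
      using old pres R.mixed.undirected_tree_parent_graph
      unfolding stretching_preserving_def expanding_preserving_def by metis
    moreover have "R.mixed(b := q b) = (\<lambda>v. if v \<in> set (ys @ [b]) then q v else p v)"
      by (auto simp: mixed fun_eq_iff)
    ultimately show ?case by simp
  qed
  from this[of xs "[]"] have "P (parent_graph V a (\<lambda>v. if v \<in> set xs then q v else p v))"
    by simp
  moreover have "parent_graph V a (\<lambda>v. if v \<in> set xs then q v else p v) = parent_graph V a q"
    using xs(2) by (intro parent_graph_cong) auto
  ultimately show ?thesis by simp
qed

section \<open>Relabelling the target\<close>

lemma digraph_iso_parent_graph:
  assumes G: "pair_graph (parent_graph V a h)" and a: "a \<in> V"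
    and f: "bij_betw f V W" "f a = r"
    and h: "\<And>v. v \<in> V \<Longrightarrow> v \<noteq> a \<Longrightarrow> h v \<in> V \<and> f (h v) = g (f v)"
  shows "digraph_iso (with_proj (parent_graph V a h)) (with_proj (parent_graph W r g))"
proof -
  interpret G: pair_graph "parent_graph V a h" by (rule G)
  let ?i = "\<lparr>iso_verts = f, iso_arcs = map_prod f f, iso_head = snd, iso_tail = fst\<rparr>"
  have inj: "inj_on f V" and W: "f ` V = W"
    using f(1) by (auto simp: bij_betw_def)
  have W': "W - {r} = f ` (V - {a})"
    using inj W f(2) a by (auto simp: inj_on_def)
  have "parcs (parent_graph V a h) \<subseteq> V \<times> V"
    using h by (auto simp: parent_graph_def)
  then have "inj_on (map_prod f f) (parcs (parent_graph V a h))"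
    using map_prod_inj_on[OF inj inj] by (rule inj_on_subset[rotated])
  then have "G.digraph_isomorphism ?i"
    using inj G.wf_digraph_axioms by (auto simp: G.digraph_isomorphism_def)
  moreover have "map_prod f f ` parcs (parent_graph V a h) = parcs (parent_graph W r g)"
    unfolding parent_graph_def using h by (simp add: W' image_UN)
  then have "with_proj (parent_graph W r g) = app_iso ?i (with_proj (parent_graph V a h))"
    by (simp add: app_iso_def with_proj_def W)
  ultimately show ?thesis unfolding digraph_iso_def by blast
qed

lemma finite_sorted_enumeration:
  fixes f :: "'b \<Rightarrow> nat"
  assumes "finite A"
  obtains xs where "distinct xs" "set xs = A" "sorted_wrt (\<lambda>x y. f x \<le> f y) xs"
proof -
  obtain ys where "distinct ys" "set ys = A"
    using finite_distinct_list[OF assms] by metis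
  then show thesis
    using sorted_sort_key[of f ys] by (intro that[of "sort_key f ys"]) (auto simp: sorted_map)
qed

lemma bij_betw_enumerations:
  assumes "distinct xs" "distinct ys" "length xs = length ys"
  obtains f where "bij_betw f (set xs) (set ys)" "map f xs = ys"
proof -
  let ?f = "\<lambda>x. the (map_of (zip xs ys) x)"
  have map: "map ?f xs = ys"
    using assms by (intro nth_equalityI) (auto simp: map_of_zip_nth)
  then have "bij_betw ?f (set xs) (set ys)"
    using assms by (metis bij_betw_def distinct_map set_map)
  with map show thesis by (intro that)
qed

theorem corollary1p5:
  fixes P :: "'a pair_pre_digraph \<Rightarrow> bool" and n :: nat
  assumes "iso_invariant P"
    and "stretching_preserving P"
    and "expanding_preserving P"
    and "\<exists>T. undirected_tree T \<and> card (pverts T) = n \<and> P T"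
  shows "\<forall>T. undirected_tree T \<and> card (pverts T) = n \<longrightarrow> P T"
proof (intro allI impI, elim conjE)
  fix S :: "'a pair_pre_digraph"
  assume S: "undirected_tree S" "card (pverts S) = n"
  obtain T where T: "undirected_tree T" "card (pverts T) = n" "P T"
    using assms(4) by metis
  let ?V = "pverts T" and ?W = "pverts S"
  obtain a p t where src: "rooted_tree ?V a p t" and Teq: "T = parent_graph ?V a p"
    and src_root: "\<And>x y. \<lbrakk>x \<in> ?V - {a}; y \<in> ?V - {a}; p x = a; p y = a\<rbrakk> \<Longrightarrow> x = y"
    using undirected_tree_rooted_at_leaf[OF T(1)] by metis
  obtain r g s where tgt: "rooted_tree ?W r g s" and Seq: "S = parent_graph ?W r g"
    and tgt_root: "\<And>x y. \<lbrakk>x \<in> ?W - {r}; y \<in> ?W - {r}; g x = r; g y = r\<rbrakk> \<Longrightarrow> x = y"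
    using undirected_tree_rooted_at_leaf[OF S(1)] by metis
  interpret src: rooted_tree ?V a p t by (rule src)
  interpret tgt: rooted_tree ?W r g s by (rule tgt)

  obtain xs where xs: "distinct xs" "set xs = ?W - {r}" "sorted_wrt (\<lambda>x y. s x \<le> s y) xs"
    using finite_sorted_enumeration[of "?W - {r}" s] tgt.finite_V by auto
  obtain ys where ys: "distinct ys" "set ys = ?V - {a}" "sorted_wrt (\<lambda>x y. t x \<le> t y) ys"
    using finite_sorted_enumeration[of "?V - {a}" t] src.finite_V by auto
  have "length xs = card (?W - {r})" "length ys = card (?V - {a})"
    using xs ys by (metis distinct_card)+
  then have "length xs = length ys"
    using S(2) T(2) src.finite_V tgt.finite_V src.root_in tgt.root_in by simp
  then obtain f where "bij_betw f (set (a # rev ys)) (set (r # xs))" "map f (a # rev ys) = r # xs"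
    using bij_betw_enumerations[of "a # rev ys" "r # xs"] xs(1,2) ys(1,2) by auto
  moreover have "set (a # rev ys) = ?V" "set (r # xs) = ?W"
    using xs(2) ys(2) src.root_in tgt.root_in by auto
  ultimately have f: "bij_betw f ?V ?W" "f a = r" "map f (rev ys) = xs" by auto
  have fW: "f v \<in> ?W" if "v \<in> ?V" for v using f(1) that by (rule bij_betw_apply)
  have f_eq: "x = y" if "f x = f y" "x \<in> ?V" "y \<in> ?V" for x y
    using f(1) that by (meson bij_betw_def inj_onD)
  have f_root: "f v \<noteq> r" if "v \<in> ?V" "v \<noteq> a" for v
    using f_eq[of v a] f(2) that src.root_in by auto

  \<comment> \<open>The parent function of \<open>S\<close> carried over to the vertices of \<open>T\<close>. The bijection \<open>f\<close> pairs the deepest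
    vertices of \<open>T\<close> with the shallowest vertices of \<open>S\<close>.\<close>
  define q where "q v = inv_into ?V f (g (f v))" for v
  have q: "q v \<in> ?V" "f (q v) = g (f v)" if v: "v \<in> ?V" "v \<noteq> a" for v
  proof -
    have "g (f v) \<in> f ` ?V"
      using tgt.parent_in[OF fW[OF v(1)] f_root[OF v]] f(1) by (simp add: bij_betw_def)
    then show "q v \<in> ?V" "f (q v) = g (f v)"
      unfolding q_def by (rule inv_into_into, rule f_inv_into_f)
  qed
  have tgt': "rooted_tree ?V a q (s \<circ> f)"
  proof
    show "finite ?V" "a \<in> ?V" by (fact src.finite_V src.root_in)+
    show "(s \<circ> f) a = 0" using f(2) tgt.depth_root by simp
    fix v assume v: "v \<in> ?V" "v \<noteq> a"
    show "q v \<in> ?V" using q(1)[OF v] .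
    show "(s \<circ> f) v = Suc ((s \<circ> f) (q v))"
      using tgt.depth_parent[OF fW[OF v(1)] f_root[OF v]] q(2)[OF v] by simp
  qed
  have tgt_root': "x = y" if "x \<in> ?V - {a}" "y \<in> ?V - {a}" "q x = a" "q y = a" for x y
  proof (rule f_eq)
    have "f x \<in> ?W - {r}" "f y \<in> ?W - {r}"
      using that(1,2) fW f_root by blast+
    moreover have "g (f x) = r" "g (f y) = r"
      using q(2)[of x] q(2)[of y] that f(2) by auto
    ultimately show "f x = f y" by (rule tgt_root)
  qed (use that(1,2) in blast)+
  have "P (parent_graph ?V a q)"
  proof (rule regrafting_preserves[OF assms(2,3) src tgt' src_root tgt_root'])
    show "distinct (rev ys)" "set (rev ys) = ?V - {a}" using ys(1,2) by auto
    show "sorted_wrt (\<lambda>x y. (s \<circ> f) x \<le> (s \<circ> f) y) (rev ys)"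
      using xs(3) unfolding f(3)[symmetric] sorted_wrt_map by simp
    show "sorted_wrt (\<lambda>x y. t y \<le> t x) (rev ys)"
      using ys(3) by (simp add: sorted_wrt_rev)
    show "P (parent_graph ?V a p)" using T(3) unfolding Teq[symmetric] .
  qed
  moreover interpret tgt': rooted_tree ?V a q "s \<circ> f" by (rule tgt')
  have "digraph_iso (with_proj (parent_graph ?V a q)) (with_proj (parent_graph ?W r g))"
    by (rule digraph_iso_parent_graph[OF tgt'.pair_graph_parent_graph src.root_in f(1,2)])
      (use q in blast)
  then have "digraph_iso (with_proj (parent_graph ?V a q)) (with_proj S)"
    unfolding Seq[symmetric] .
  ultimately show "P S"
    using assms(1) S(1) tgt'.undirected_tree_parent_graph unfolding iso_invariant_def by metis
qed

end
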